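(* Let $p\geq 2$ be a large prime, and let $q<p$ be a (positive) integer. Then the finite field $\mathbb{F}_p$ contains primitive roots relatively prime to $q$. Furthermore, the number $N_r(p,q)$ of such elements satisfies $$N_r(p,q)=\frac{\varphi(q)}{q}\,\frac{\varphi(p-1)}{p-1}\,p+O\left(p^{1-\varepsilon}\right),$$ where $\varepsilon>0$ is an arbitrarily small number.
   Context: An element $\alpha\in\mathbb{F}_p$ is a primitive root if its multiplicative order $\mathrm{ord}_p(\alpha)$ equals $p-1$. Elements $n\in\mathbb{F}_p$ are identified with their integer representatives $0\leq n\leq p-1$ when considering $\gcd(n,q)$. Then $$N_r(p,q)=\#\{n\in\mathbb{F}_p:\ \mathrm{ord}_p(n)=p-1 \text{ and } \gcd(n,q)=1\}.$$ $\varphi$ is Euler's totient function. "Large prime" means $p$ sufficiently large, and asymptotics are for $p\to\infty$. *)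

theory Defs
  imports "HOL-Number_Theory.Number_Theory"
begin

text \<open>Elements of the prime field with \<open>p\<close> elements are represented by the integers
  \<open>0, ..., p - 1\<close>, and \<^const>\<open>ord\<close> is the multiplicative order modulo its first argument.
  Note that \<open>ord p 0 = 0\<close> for \<open>p > 1\<close>, so \<open>0\<close> is not a primitive root modulo a prime.\<close>

definition primitive_roots :: "nat \<Rightarrow> nat set" where
  "primitive_roots p = {n \<in> {0..<p}. ord p n = p - 1}"

definition N_r :: "nat \<Rightarrow> nat \<Rightarrow> nat" where
  "N_r p q = card {n \<in> primitive_roots p. gcd n q = 1}"

end

theory Submission
  imports Defs "HOL-Analysis.Harmonic_Numbers" "HOL-Real_Asymp.Real_Asymp"
begin

text \<open>
  No multiplicative characters are used. By inclusion-exclusion over the prime factors \<open>r\<close> of \<open>p - 1\<close>,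
  the set of primitive roots is a signed combination of subgroups of the multiplicative group cut out by
  conditions \<open>x ^ ((p - 1) div r) = 1\<close>, and the nontrivial additive Fourier coefficients of a subgroup are
  at most \<open>sqrt p\<close>. Expanding the indicator function of the multiples of \<open>d\<close> below \<open>p\<close> into additive
  characters, whose Fourier coefficients have total size \<open>O(p ln p)\<close>, shows that
  \<open>\<phi>(p - 1) / d\<close> primitive roots are divisible by \<open>d\<close> up to an error of
  \<open>1 + 2 ^ \<omega>(p - 1) * sqrt p * (1 + ln p)\<close>. A second inclusion-exclusion over the prime factors of \<open>q\<close>
  gives the count, and \<open>2 ^ \<omega>(n) = O(n powr \<delta>)\<close> makes the error \<open>O(p powr (1 / 2 + 4 * \<delta>))\<close>.
\<close>

section \<open>Weighted inclusion-exclusion\<close>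

lemma sum_sieve:
  fixes f :: "'a \<Rightarrow> 'c :: comm_ring_1"
  assumes "finite X" "finite P"
  shows "(\<Sum>x | x \<in> X \<and> (\<forall>r\<in>P. \<not> Q r x). f x) =
         (\<Sum>S\<in>Pow P. (-1) ^ card S * (\<Sum>x | x \<in> X \<and> (\<forall>r\<in>S. Q r x). f x))"
proof -
  have prod_bool: "(\<Prod>r\<in>S. of_bool (Q' r)) = (of_bool (\<forall>r\<in>S. Q' r) :: 'c)"
    if "finite S" for S and Q' :: "'b \<Rightarrow> bool"
    using that by (induction S) auto
  have "(\<Sum>x | x \<in> X \<and> (\<forall>r\<in>P. \<not> Q r x). f x) = (\<Sum>x\<in>X. f x * of_bool (\<forall>r\<in>P. \<not> Q r x))"
    using assms(1) by (intro sum.mono_neutral_cong_left) auto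
  \<comment> \<open>The indicator of "no \<open>Q r x\<close> holds" is a product of factors
    \<open>1 - of_bool (Q r x)\<close>; expanding it over the subsets of \<open>P\<close> gives the
    signs.\<close>
  also have "\<dots> = (\<Sum>x\<in>X. f x * (\<Prod>r\<in>P. 1 - of_bool (Q r x)))"
    by (intro sum.cong refl, subst prod_bool[OF assms(2), symmetric])
       (auto intro!: arg_cong2[where f = "(*)"] prod.cong)
  also have "\<dots> = (\<Sum>x\<in>X. \<Sum>S\<in>Pow P. (-1) ^ card S * (f x * of_bool (\<forall>r\<in>S. Q r x)))"
    using assms(2) by (intro sum.cong refl)
      (auto simp: prod_diff_conv_sum prod_bool sum_distrib_left mult_ac
            intro!: sum.cong dest: finite_subset)
  also have "\<dots> = (\<Sum>S\<in>Pow P. \<Sum>x\<in>X. (-1) ^ card S * (f x * of_bool (\<forall>r\<in>S. Q r x)))"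
    by (rule sum.swap)
  also have "\<dots> = (\<Sum>S\<in>Pow P. (-1) ^ card S * (\<Sum>x | x \<in> X \<and> (\<forall>r\<in>S. Q r x). f x))"
    using assms(1) unfolding sum_distrib_left[symmetric]
    by (intro sum.cong refl arg_cong2[where f = "(*)"] sum.mono_neutral_cong_right) auto
  finally show ?thesis .
qed

subsection \<open>Additive characters\<close>

definition add_char :: "nat \<Rightarrow> int \<Rightarrow> complex" where
  "add_char p k = cis (2 * pi * of_int k / of_nat p)"

lemma add_char_0 [simp]: "add_char p 0 = 1"
  by (simp add: add_char_def)

lemma norm_add_char [simp]: "norm (add_char p k) = 1"
  by (simp add: add_char_def)

lemma add_char_add: "add_char p (j + k) = add_char p j * add_char p k"
  by (simp add: add_char_def cis_mult add_divide_distrib algebra_simps)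

lemma add_char_cnj: "cnj (add_char p k) = add_char p (-k)"
  by (simp add: add_char_def cis_cnj)

lemma add_char_power: "add_char p k ^ n = add_char p (int n * k)"
  unfolding add_char_def Complex.DeMoivre by (simp add: mult_ac)

lemma add_char_mod:
  assumes "p > 0"
  shows "add_char p (k mod int p) = add_char p k"
proof -
  have "add_char p k = add_char p (int p * (k div int p)) * add_char p (k mod int p)"
    by (simp flip: add_char_add)
  also have "add_char p (int p * (k div int p)) = cis (2 * pi * of_int (k div int p))"
    using assms by (simp add: add_char_def mult.assoc del: cis_multiple_2pi)
  also have "\<dots> = 1" by (rule cis_multiple_2pi) simp
  finally show ?thesis by simp
qed

lemma add_char_cong:
  assumes "p > 0" "[j = k] (mod int p)"
  shows "add_char p j = add_char p k"
  using assms by (metis add_char_mod Cong.cong_def)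

text \<open>The minorant vanishes at both ends of the unit interval, so one formula covers residues
  near 0 and near p. Its reciprocal splits into partial fractions 1/t and 1/(1 - t), which later
  produce harmonic sums.\<close>

lemma sin_pi_times_ge:
  fixes t :: real
  assumes "0 \<le> t" "t \<le> 1"
  shows "2 * t * (1 - t) \<le> sin (pi * t)"
proof -
  have half: "2 * s \<le> sin (pi * s)" if "0 \<le> s" "s \<le> 1 / 2" for s :: real
  proof -
    have "concave_on {0..pi} sin"
      by (rule f''_le0_imp_concave[where f' = cos and f'' = "\<lambda>x. - sin x"])
         (auto intro!: derivative_eq_intros sin_ge_zero)
    \<comment> \<open>Concavity puts the sine above its chord from 0 to pi/2.\<close>
    from concave_onD[OF this, of "2 * s" 0 "pi / 2"] that show ?thesis
      by (simp add: mult.commute)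
  qed
  show ?thesis
  proof (cases "t \<le> 1 / 2")
    case True
    have "2 * t * (1 - t) \<le> 2 * t * 1" using assms by (intro mult_left_mono) auto
    with half[of t] True assms show ?thesis by simp
  next
    case False
    have "2 * t * (1 - t) \<le> 2 * 1 * (1 - t)"
      using assms by (intro mult_right_mono) auto
    also have "\<dots> \<le> sin (pi * (1 - t))"
      using half[of "1 - t"] False assms by simp
    also have "\<dots> = sin (pi * t)" by (simp add: algebra_simps)
    finally show ?thesis .
  qed
qed

lemma norm_one_minus_cis: "norm (1 - cis (2 * t)) = 2 * \<bar>sin t\<bar>"
proof -
  have "1 - cis (2 * t) = - (cis t * complex_of_real (2 * sin t) * \<i>)"
    by (auto simp: complex_eq_iff cos_double_sin sin_double power2_eq_square)
  thus ?thesis by (simp add: norm_mult)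
qed

lemma norm_one_minus_add_char_ge:
  assumes "0 < b" "b < p"
  shows "4 * (real b / p) * (1 - real b / p) \<le> norm (1 - add_char p (int b))"
proof -
  have "norm (1 - add_char p (int b)) = 2 * \<bar>sin (pi * (real b / p))\<bar>"
    using norm_one_minus_cis[of "pi * (real b / p)"] by (simp add: add_char_def mult_ac)
  with sin_pi_times_ge[of "real b / p"] assms show ?thesis by simp
qed

text \<open>The forward direction reuses the quantitative bound: for a nonzero residue b the lower
  bound for the distance from \<open>add_char p (int b)\<close> to 1 is strictly positive.\<close>

lemma add_char_eq_1_iff:
  assumes "p > 0"
  shows "add_char p k = 1 \<longleftrightarrow> int p dvd k"
proof
  assume *: "add_char p k = 1"
  define b where "b = nat (k mod int p)"
  have b: "int b = k mod int p" "b < p" using assms by (auto simp: b_def nat_less_iff)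
  have "b = 0"
  proof (rule ccontr)
    assume "b \<noteq> 0"
    moreover have "add_char p (int b) = 1" using * assms b by (simp add: add_char_mod)
    ultimately have "4 * (real b / p) * (1 - real b / p) \<le> 0"
      using norm_one_minus_add_char_ge[of b p] b by simp
    moreover have "4 * (real b / p) * (1 - real b / p) > 0"
      using b(2) \<open>b \<noteq> 0\<close> by (intro mult_pos_pos) auto
    ultimately show False by simp
  qed
  with b show "int p dvd k" by auto
next
  assume "int p dvd k"
  thus "add_char p k = 1" using add_char_mod[OF assms, of k] by simp
qed

lemma sum_add_char:
  assumes "p > 0"
  shows "(\<Sum>a<p. add_char p (int a * k)) = (if int p dvd k then of_nat p else 0)"
proof -
  have "(\<Sum>a<p. add_char p (int a * k)) = (\<Sum>a<p. add_char p k ^ a)"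
    by (simp add: add_char_power)
  also have "add_char p k ^ p = 1"
    using assms by (simp add: add_char_power add_char_eq_1_iff)
  hence "(\<Sum>a<p. add_char p k ^ a) = (if int p dvd k then of_nat p else 0)"
    using assms by (simp add: sum_gp_strict add_char_eq_1_iff)
  finally show ?thesis .
qed

subsection \<open>Fourier coefficients of subsets of the residues\<close>

definition fourier :: "nat \<Rightarrow> nat set \<Rightarrow> nat \<Rightarrow> complex" where
  "fourier p A a = (\<Sum>x\<in>A. add_char p (int a * int x))"

lemma fourier_0 [simp]: "fourier p A 0 = of_nat (card A)"
  by (simp add: fourier_def)

lemma fourier_mod: "p > 0 \<Longrightarrow> fourier p A (a mod p) = fourier p A a"
  unfolding fourier_def
  by (intro sum.cong refl add_char_cong cong_mult) (simp_all add: Cong.cong_def zmod_int)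

text \<open>Plancherel for indicator functions: once the sums are swapped, orthogonality over a
  leaves only x = y, since residues below p that agree modulo p are equal. The case B = A is
  Parseval; with B the multiples of d it counts the elements of A divisible by d.\<close>

lemma fourier_inner:
  assumes p: "p > 0" and "A \<subseteq> {..<p}" "B \<subseteq> {..<p}"
  shows "(\<Sum>a<p. fourier p A a * cnj (fourier p B a)) = of_nat (p * card (A \<inter> B))"
proof -
  have fin: "finite A" "finite B" using assms by (auto intro: finite_subset)
  have "(\<Sum>a<p. fourier p A a * cnj (fourier p B a)) =
        (\<Sum>a<p. \<Sum>x\<in>A. \<Sum>y\<in>B. add_char p (int a * (int x - int y)))"
    by (simp add: fourier_def sum_product add_char_cnj algebra_simps flip: add_char_add)
  also have "\<dots> = (\<Sum>x\<in>A. \<Sum>y\<in>B. \<Sum>a<p. add_char p (int a * (int x - int y)))"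
    by (subst sum.swap, rule sum.cong[OF refl], rule sum.swap)
  also have "\<dots> = (\<Sum>x\<in>A. \<Sum>y\<in>B. if x = y then of_nat p else 0)"
  proof (intro sum.cong refl)
    fix x y assume "x \<in> A" "y \<in> B"
    hence "x < p" "y < p" using assms by auto
    hence "int p dvd int x - int y \<longleftrightarrow> x = y"
      by (metis cong_iff_dvd_diff cong_int_iff cong_less_modulus_unique_nat cong_refl)
    thus "(\<Sum>a<p. add_char p (int a * (int x - int y))) = (if x = y then of_nat p else 0)"
      using sum_add_char[OF p] by simp
  qed
  also have "\<dots> = (\<Sum>x\<in>A. if x \<in> B then of_nat p else 0)"
    using fin by (intro sum.cong refl) (auto simp: sum.delta')
  also have "\<dots> = of_nat (p * card (A \<inter> B))"
    using fin by (simp add: sum.If_cases Int_def)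
  finally show ?thesis .
qed

lemma parseval:
  assumes "p > 0" "A \<subseteq> {..<p}"
  shows "(\<Sum>a<p. (norm (fourier p A a))\<^sup>2) = real (p * card A)"
proof -
  have "complex_of_real (\<Sum>a<p. (norm (fourier p A a))\<^sup>2) = complex_of_real (real (p * card A))"
    using fourier_inner[OF assms(1,2,2)]
    by (simp flip: complex_norm_square)
  thus ?thesis by (simp only: of_real_eq_iff)
qed

section \<open>The square-root bound for multiplicative subgroups\<close>

lemma inj_on_mult_mod_prime:
  fixes p :: nat
  assumes "prime p" "0 < c" "c < p"
  shows "inj_on (\<lambda>x. c * x mod p) {..<p}"
proof (rule inj_onI)
  fix x y assume *: "x \<in> {..<p}" "y \<in> {..<p}" "c * x mod p = c * y mod p"
  have "coprime c p"
    using assms by (metis coprime_commute nat_dvd_not_less prime_imp_coprime)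
  hence "[x = y] (mod p)" using * by (simp add: Cong.cong_def[symmetric] cong_mult_lcancel_nat)
  thus "x = y" using * by (simp add: cong_less_modulus_unique_nat)
qed

text \<open>Since \<open>fourier p H\<close> is constant on cosets of \<open>H\<close>, Parseval's identity gives
  \<open>card H * |fourier p H a|^2 \<le> p * card H\<close>.\<close>

lemma norm_fourier_subgroup_le:
  fixes p :: nat
  assumes p: "prime p" and H: "H \<subseteq> {1..<p}"
    and closed: "\<And>x y. x \<in> H \<Longrightarrow> y \<in> H \<Longrightarrow> x * y mod p \<in> H"
    and a: "0 < a" "a < p"
  shows "norm (fourier p H a) \<le> sqrt p"
proof (cases "H = {}")
  case False
  have fin: "finite H" using H by (auto intro: finite_subset)
  have p0: "p > 0" using p by (simp add: prime_gt_0_nat)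
  have coset: "fourier p H (a * h mod p) = fourier p H a" if "h \<in> H" for h
  proof -
    have inj: "inj_on (\<lambda>x. h * x mod p) H"
      using H that by (intro inj_on_subset[OF inj_on_mult_mod_prime[OF p, of h]]) auto
    \<comment> \<open>An injective self-map of a finite set is onto, so closure under products makes
      multiplication by \<open>h\<close> a permutation of \<open>H\<close>.\<close>
    have "(\<lambda>x. h * x mod p) ` H = H"
      using inj fin closed that by (intro endo_inj_surj) auto
    hence "fourier p H a = (\<Sum>x\<in>(\<lambda>x. h * x mod p) ` H. add_char p (int a * int x))"
      by (simp add: fourier_def)
    also have "\<dots> = (\<Sum>x\<in>H. add_char p (int a * int (h * x mod p)))"
      by (subst sum.reindex[OF inj]) simp
    also have "\<dots> = fourier p H (a * h)"
      unfolding fourier_def using p0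
      by (intro sum.cong refl add_char_cong)
         (simp_all add: Cong.cong_def zmod_int mod_mult_right_eq mult.assoc)
    finally show ?thesis using p0 by (simp add: fourier_mod)
  qed
  have inj: "inj_on (\<lambda>h. a * h mod p) H"
    using H by (intro inj_on_subset[OF inj_on_mult_mod_prime[OF p a]]) auto
  have "real (card H) * (norm (fourier p H a))\<^sup>2 =
        (\<Sum>b\<in>(\<lambda>h. a * h mod p) ` H. (norm (fourier p H b))\<^sup>2)"
    by (subst sum.reindex[OF inj]) (simp add: coset)
  also have "\<dots> \<le> (\<Sum>b<p. (norm (fourier p H b))\<^sup>2)"
    using p0 by (intro sum_mono2) auto
  also have "\<dots> = real (card H) * real p"
    using H p0 by (subst parseval) auto
  finally have "(norm (fourier p H a))\<^sup>2 \<le> real p"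
    using False fin by (simp add: card_gt_0_iff)
  thus ?thesis by (rule real_le_rsqrt)
qed (simp add: fourier_def)

subsection \<open>Equidistribution among multiples\<close>

lemma harm_le_1_plus_ln:
  assumes "n > 0"
  shows "harm n \<le> 1 + ln (real n)"
  using euler_mascheroni_sequence_decreasing[of 1 n] assms by (simp add: harm_expand)

text \<open>The closed form of the geometric sum has numerator of norm at most 2, whatever its
  length M; the sine bound controls the denominator.\<close>

lemma norm_geometric_add_char_le:
  assumes "0 < b" "b < p"
  shows "norm (\<Sum>m<M. add_char p (int b * int m)) \<le> (real p / b + real p / (p - b)) / 2"
proof -
  define z where "z = add_char p (int b)"
  define t where "t = real b / p"
  have t: "0 < t" "t < 1" using assms by (auto simp: t_def)
  have ge: "4 * t * (1 - t) \<le> norm (1 - z)"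
    using norm_one_minus_add_char_ge[OF assms] by (simp add: z_def t_def)
  moreover have pos: "4 * t * (1 - t) > 0" using t by simp
  ultimately have "z \<noteq> 1" by auto
  have "(\<Sum>m<M. add_char p (int b * int m)) = (\<Sum>m<M. z ^ m)"
    by (simp add: z_def add_char_power mult.commute)
  also have "norm \<dots> = norm (1 - z ^ M) / norm (1 - z)"
    using \<open>z \<noteq> 1\<close> by (simp add: sum_gp_strict norm_divide)
  also have "\<dots> \<le> 2 / (4 * t * (1 - t))"
  proof (rule frac_le[OF _ _ pos ge])
    have "norm (1 - z ^ M) \<le> norm (1 :: complex) + norm (z ^ M)" by (rule norm_triangle_ineq4)
    thus "norm (1 - z ^ M) \<le> 2" by (simp add: z_def norm_power)
  qed simp
  also have "\<dots> = (1 / t + 1 / (1 - t)) / 2"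
    using t by (simp add: field_simps)
  also have "1 / (1 - t) = real p / (p - b)"
    using assms by (simp add: t_def field_simps of_nat_diff)
  finally show ?thesis by (simp add: t_def)
qed

lemma sum_norm_geometric_add_char_le:
  fixes p :: nat
  assumes "p > 1"
  shows "(\<Sum>b\<in>{1..<p}. norm (\<Sum>m<M. add_char p (int b * int m))) \<le> real p * (1 + ln p)"
proof -
  have "(\<Sum>b\<in>{1..<p}. norm (\<Sum>m<M. add_char p (int b * int m)))
        \<le> (\<Sum>b\<in>{1..<p}. (real p / b + real p / (p - b)) / 2)"
    by (intro sum_mono norm_geometric_add_char_le) auto
  also have "\<dots> = ((\<Sum>b\<in>{1..<p}. real p / b) + (\<Sum>b\<in>{1..<p}. real p / real (p - b))) / 2"
    by (simp add: sum.distrib flip: sum_divide_distrib)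
  \<comment> \<open>The reflection b -> p - b turns the second half into the first, so both are the
    same harmonic sum.\<close>
  also have "(\<Sum>b\<in>{1..<p}. real p / real (p - b)) = (\<Sum>b\<in>{1..<p}. real p / b)"
    by (rule sum.reindex_bij_witness[of _ "\<lambda>b. p - b" "\<lambda>b. p - b"]) auto
  also have "(\<Sum>b\<in>{1..<p}. real p / b) = (\<Sum>b\<in>{1..p - 1}. real p / b)"
    using assms by (intro sum.cong) auto
  also have "(\<Sum>b\<in>{1..p - 1}. real p / b) = real p * harm (p - 1)"
    by (simp add: harm_def sum_distrib_left divide_inverse)
  also have "(real p * harm (p - 1) + real p * harm (p - 1)) / 2 = real p * harm (p - 1)"
    by simp
  also have "\<dots> \<le> real p * (1 + ln p)"
  proof (intro mult_left_mono)
    have "harm (p - 1) \<le> (harm p :: real)" by (intro harm_mono) simp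
    also have "\<dots> \<le> 1 + ln p" using assms by (intro harm_le_1_plus_ln) simp
    finally show "harm (p - 1) \<le> 1 + ln (real p)" .
  qed simp
  finally show ?thesis .
qed

text \<open>The extra 1 in the range of m accounts for the multiple 0.\<close>

lemma multiples_less_eq_image:
  fixes n d :: nat
  assumes "n > 0" "d > 0"
  shows "{x. x < n \<and> d dvd x} = (\<lambda>m. d * m) ` {..<(n - 1) div d + 1}"
proof -
  have "d * m < n \<longleftrightarrow> m < (n - 1) div d + 1" for m
  proof -
    have "m < (n - 1) div d + 1 \<longleftrightarrow> m * d \<le> n - 1"
      using assms by (simp add: less_Suc_eq_le less_eq_div_iff_mult_less_eq)
    thus ?thesis using assms by (auto simp: mult.commute)
  qed
  thus ?thesis by (auto simp: dvd_def)
qed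

text \<open>The coefficient at a is a geometric sum of frequency d * a mod p. As d is invertible
  modulo p, these frequencies permute the nonzero residues, so the bound is uniform in d.\<close>

lemma sum_norm_fourier_multiples_le:
  fixes p d :: nat
  assumes p: "prime p" and d: "0 < d" "d < p"
  shows "(\<Sum>a\<in>{1..<p}. norm (fourier p {x. x < p \<and> d dvd x} a)) \<le> real p * (1 + ln p)"
proof -
  have p1: "p > 1" using p by (rule prime_gt_1_nat)
  define M where "M = (p - 1) div d + 1"
  have J: "{x. x < p \<and> d dvd x} = (\<lambda>m. d * m) ` {..<M}"
    unfolding M_def using p1 d by (intro multiples_less_eq_image) auto
  define K where "K b = (\<Sum>m<M. add_char p (int b * int m))" for b
  have fourier_eq: "fourier p {x. x < p \<and> d dvd x} a = K (d * a mod p)" for a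
  proof -
    have "fourier p {x. x < p \<and> d dvd x} a = (\<Sum>m<M. add_char p (int a * int (d * m)))"
      unfolding J fourier_def using d by (subst sum.reindex) (auto intro!: inj_onI)
    also have "\<dots> = K (d * a mod p)"
      unfolding K_def using p1
      by (intro sum.cong refl add_char_cong)
         (simp_all add: Cong.cong_def zmod_int mod_mult_right_eq mult_ac)
    finally show ?thesis .
  qed
  have inj: "inj_on (\<lambda>a. d * a mod p) {1..<p}"
    by (rule inj_on_subset[OF inj_on_mult_mod_prime[OF p d]]) auto
  have "d * a mod p \<in> {1..<p}" if "a \<in> {1..<p}" for a
  proof -
    have "\<not> p dvd d" "\<not> p dvd a" using that d by (auto dest: dvd_imp_le)
    hence "d * a mod p \<noteq> 0"
      using p by (metis mod_eq_0_iff_dvd prime_dvd_mult_iff)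
    thus ?thesis using p1 by simp
  qed
  hence img: "(\<lambda>a. d * a mod p) ` {1..<p} = {1..<p}"
    using inj by (intro endo_inj_surj) auto
  have "(\<Sum>a\<in>{1..<p}. norm (fourier p {x. x < p \<and> d dvd x} a)) =
        (\<Sum>b\<in>(\<lambda>a. d * a mod p) ` {1..<p}. norm (K b))"
    by (subst sum.reindex[OF inj]) (simp add: fourier_eq)
  also have "\<dots> \<le> real p * (1 + ln p)"
    unfolding img K_def using p1 by (rule sum_norm_geometric_add_char_le)
  finally show ?thesis .
qed

section \<open>Counting multiples in sets with small Fourier coefficients\<close>

lemma card_multiples_less:
  fixes p d :: nat
  assumes "p > 0" "d > 0"
  shows "\<bar>real (card {x. x < p \<and> d dvd x}) - real p / d\<bar> \<le> 1"
proof -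
  define k where "k = (p - 1) div d"
  have "inj_on (\<lambda>m. d * m) {..<k + 1}" using assms by (intro inj_onI) simp
  hence card: "card {x. x < p \<and> d dvd x} = k + 1"
    unfolding multiples_less_eq_image[OF assms] k_def[symmetric] by (simp add: card_image)
  have "p - 1 = k * d + (p - 1) mod d" unfolding k_def by simp
  moreover have "(p - 1) mod d < d" using assms by simp
  ultimately have "k * d \<le> p" "p \<le> k * d + d" using assms by linarith+
  hence "real k * real d \<le> real p" "real p \<le> (real k + 1) * real d"
    by (simp_all add: distrib_right flip: of_nat_mult of_nat_add)
  hence "real k \<le> real p / real d" "real p / real d \<le> real k + 1"
    using assms by (simp_all add: pos_le_divide_eq pos_divide_le_eq)
  thus ?thesis unfolding card by simp
qed

text \<open>In Plancherel's identity for A and the set J of multiples, the frequency 0 contributes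
  the main term card A * card J / p, and the others cost B times the total size of the coefficients
  of J. The summand 1 pays for replacing card J by p / d, as card A is at most p.\<close>

lemma multiples_equidistributed:
  fixes p d :: nat
  assumes p: "prime p" and d: "0 < d" "d < p" and A: "A \<subseteq> {..<p}"
    and B: "\<And>a. 0 < a \<Longrightarrow> a < p \<Longrightarrow> norm (fourier p A a) \<le> B"
  shows "\<bar>real (card {x \<in> A. d dvd x}) - real (card A) / d\<bar> \<le> 1 + B * (1 + ln p)"
proof -
  define J where "J = {x. x < p \<and> d dvd x}"
  have p0: "p > 0" using p by (rule prime_gt_0_nat)
  have AJ: "{x \<in> A. d dvd x} = A \<inter> J" using A by (auto simp: J_def)
  define E where "E = (\<Sum>a\<in>{1..<p}. fourier p A a * cnj (fourier p J a))"
  have "norm E \<le> (\<Sum>a\<in>{1..<p}. B * norm (fourier p J a))"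
    unfolding E_def by (rule sum_norm_le) (auto simp: norm_mult intro!: mult_right_mono B)
  also have "\<dots> = B * (\<Sum>a\<in>{1..<p}. norm (fourier p J a))"
    by (simp add: sum_distrib_left)
  also have "\<dots> \<le> B * (real p * (1 + ln p))"
  proof (rule mult_left_mono)
    \<comment> \<open>\<open>B\<close> is nonnegative because it bounds a norm at the frequency 1,
      which is below p.\<close>
    have "norm (fourier p A 1) \<le> B" using prime_gt_1_nat[OF p] by (intro B) auto
    thus "0 \<le> B" using norm_ge_zero order_trans by blast
  qed (use sum_norm_fourier_multiples_le[OF p d] in \<open>simp add: J_def\<close>)
  finally have E: "norm E \<le> B * (real p * (1 + ln p))" .
  have "of_nat (p * card (A \<inter> J)) = (\<Sum>a<p. fourier p A a * cnj (fourier p J a))"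
    using A p0 by (subst fourier_inner) (auto simp: J_def)
  also have "{..<p} = insert 0 {1..<p}" using p0 by auto
  also have "(\<Sum>a\<in>insert 0 {1..<p}. fourier p A a * cnj (fourier p J a)) =
             of_nat (card A * card J) + E"
    by (simp add: E_def)
  finally have "E = complex_of_real (real p * card (A \<inter> J) - real (card A) * card J)"
    by simp
  hence "\<bar>real p * card (A \<inter> J) - real (card A) * card J\<bar> \<le> B * (real p * (1 + ln p))"
    using E by (simp only: norm_of_real)
  hence "\<bar>real (card (A \<inter> J)) - real (card A) * card J / p\<bar> \<le> B * (1 + ln p)"
    using p0 by (simp add: abs_le_iff field_simps)
  moreover have "\<bar>real (card A) * card J / p - real (card A) / d\<bar> \<le> 1"
  proof -
    have "card A \<le> p" using card_mono[OF _ A] by simp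
    have "real (card A) * card J / p - real (card A) / d =
            real (card A) / p * (real (card J) - real p / d)"
      using p0 d by (simp add: field_simps)
    also have "\<bar>\<dots>\<bar> \<le> 1 * 1"
      unfolding abs_mult using \<open>card A \<le> p\<close> p0 d card_multiples_less[of p d]
      by (intro mult_mono) (auto simp: J_def)
    finally show ?thesis by simp
  qed
  ultimately show ?thesis unfolding AJ by linarith
qed

subsection \<open>Sieving by prime factors\<close>

text \<open>Distinct primes are coprime. This turns the joint condition of a sieve term into
  divisibility by a single squarefree number.\<close>

lemma prod_primes_dvd_iff:
  fixes n :: nat
  assumes "finite S" "\<And>r. r \<in> S \<Longrightarrow> prime r"
  shows "\<Prod>S dvd n \<longleftrightarrow> (\<forall>r\<in>S. r dvd n)"
proof
  show "\<forall>r\<in>S. r dvd n" if "\<Prod>S dvd n"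
    using dvd_prod_eqI[OF assms(1)] that dvd_trans by blast
  show "\<Prod>S dvd n" if "\<forall>r\<in>S. r dvd n"
    using assms that
  proof (induction S)
    case (insert r S)
    have "coprime r (\<Prod>S)"
      using insert by (intro prod_coprime_right) (auto intro!: primes_coprime)
    thus ?case using insert by (auto intro!: divides_mult)
  qed auto
qed

lemma coprime_iff_no_common_prime_factor:
  fixes n q :: nat
  assumes "q > 0"
  shows "coprime n q \<longleftrightarrow> (\<forall>r\<in>prime_factors q. \<not> r dvd n)"
proof
  assume "coprime n q"
  thus "\<forall>r\<in>prime_factors q. \<not> r dvd n"
    by (metis coprime_common_divisor in_prime_factors_iff not_prime_unit)
next
  assume *: "\<forall>r\<in>prime_factors q. \<not> r dvd n"
  show "coprime n q"
  proof (rule ccontr)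
    assume "\<not> coprime n q"
    hence "gcd n q \<noteq> 1" using coprime_iff_gcd_eq_1 by blast
    then obtain r where "prime r" "r dvd gcd n q"
      using prime_factor_nat by blast
    thus False using * assms by (auto simp: in_prime_factors_iff)
  qed
qed

text \<open>The order divides p - 1; if it is a proper divisor, any prime r dividing the cofactor
  makes it divide (p - 1) div r. Each condition negated on the right is preserved by products, which
  is the form the sieve over subgroups requires.\<close>

lemma primitive_root_iff:
  fixes p x :: nat
  assumes p: "prime p" and x: "0 < x" "x < p"
  shows "ord p x = p - 1 \<longleftrightarrow> (\<forall>r\<in>prime_factors (p - 1). \<not> [x ^ ((p - 1) div r) = 1] (mod p))"
proof -
  have p1: "p > 1" using p by (rule prime_gt_1_nat)
  have "coprime p x" using assms by (metis nat_dvd_not_less prime_imp_coprime)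
  hence dvd: "ord p x dvd p - 1"
    using order_divides_totient[of p x] p by (simp add: totient_prime)
  have "(\<exists>r\<in>prime_factors (p - 1). ord p x dvd (p - 1) div r)" if neq: "ord p x \<noteq> p - 1"
  proof -
    from dvd obtain k where k: "p - 1 = ord p x * k" by (elim dvdE)
    with neq have "k \<noteq> 1" by auto
    then obtain r j where r: "prime r" "k = r * j" using prime_factor_nat[of k] by (auto elim!: dvdE)
    have "r > 0" using r(1) by (rule prime_gt_0_nat)
    have "r dvd p - 1" using k r(2) by simp
    hence "r \<in> prime_factors (p - 1)" using r(1) p1 by (simp add: in_prime_factors_iff)
    moreover have "(p - 1) div r = ord p x * j" using k r(2) \<open>r > 0\<close> by simp
    ultimately show ?thesis by (metis dvd_triv_left)
  qed
  moreover have "\<not> ord p x dvd (p - 1) div r"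
    if "r \<in> prime_factors (p - 1)" "ord p x = p - 1" for r
  proof -
    from that have r: "prime r" "r dvd p - 1" by (auto simp: in_prime_factors_iff)
    have "r > 1" "r \<le> p - 1" using r p1 prime_gt_1_nat[of r] by (auto intro: dvd_imp_le)
    hence "(p - 1) div r < p - 1" "(p - 1) div r > 0"
      using p1 by (auto intro: div_less_dividend simp: div_greater_zero_iff)
    thus ?thesis unfolding that(2) by (metis nat_dvd_not_less)
  qed
  ultimately show ?thesis unfolding ord_divides by blast
qed

lemma norm_fourier_primitive_roots_le:
  fixes p :: nat
  assumes p: "prime p" and a: "0 < a" "a < p"
  shows "norm (fourier p (primitive_roots p) a) \<le> 2 ^ card (prime_factors (p - 1)) * sqrt p"
proof -
  have p1: "p > 1" using p by (rule prime_gt_1_nat)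
  define Q where "Q r x \<longleftrightarrow> [x ^ ((p - 1) div r) = 1] (mod p)" for r x
  define H where "H S = {x. x \<in> {1..<p} \<and> (\<forall>r\<in>S. Q r x)}" for S
  have "primitive_roots p = {x. x \<in> {1..<p} \<and> (\<forall>r\<in>prime_factors (p - 1). \<not> Q r x)}"
  proof -
    \<comment> \<open>At x = 0 the order is 0, which differs from p - 1, so 0 lies in neither
      set.\<close>
    have "x \<in> primitive_roots p \<longleftrightarrow> x \<in> {1..<p} \<and> (\<forall>r\<in>prime_factors (p - 1). \<not> Q r x)" for x
      using primitive_root_iff[OF p, of x] p1
      by (cases "x = 0") (auto simp: primitive_roots_def Q_def)
    thus ?thesis by blast
  qed
  hence "fourier p (primitive_roots p) a =
         (\<Sum>S\<in>Pow (prime_factors (p - 1)). (-1) ^ card S * fourier p (H S) a)"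
    \<comment> \<open>Here the weight in the sieve is the additive character at frequency
      \<open>a\<close>.\<close>
    by (simp only: fourier_def H_def, subst sum_sieve) auto
  also have "norm \<dots> \<le> (\<Sum>S\<in>Pow (prime_factors (p - 1)). sqrt p)"
  proof (rule sum_norm_le)
    fix S
    have "norm (fourier p (H S) a) \<le> sqrt p"
    proof (rule norm_fourier_subgroup_le[OF p _ _ a])
      fix x y assume xy: "x \<in> H S" "y \<in> H S"
      have "\<not> p dvd x" "\<not> p dvd y" using xy by (auto simp: H_def dest: dvd_imp_le)
      hence "x * y mod p \<noteq> 0"
        using p by (metis mod_eq_0_iff_dvd prime_dvd_mult_iff)
      moreover have "Q r (x * y mod p)" if "r \<in> S" for r
      proof -
        have "[(x * y mod p) ^ ((p - 1) div r) = (x * y) ^ ((p - 1) div r)] (mod p)"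
          by (intro cong_pow) (simp add: Cong.cong_def)
        also have "(x * y) ^ ((p - 1) div r) = x ^ ((p - 1) div r) * y ^ ((p - 1) div r)"
          by (rule power_mult_distrib)
        also have "[\<dots> = 1 * 1] (mod p)"
          using xy that by (intro cong_mult) (auto simp: H_def Q_def)
        finally show ?thesis by (simp add: Q_def)
      qed
      ultimately show "x * y mod p \<in> H S"
        using p1 by (simp add: H_def)
    qed (auto simp: H_def)
    thus "norm ((-1) ^ card S * fourier p (H S) a) \<le> sqrt p"
      by (simp add: norm_mult norm_power)
  qed
  also have "\<dots> = 2 ^ card (prime_factors (p - 1)) * sqrt p"
    by (simp add: card_Pow)
  finally show ?thesis .
qed

text \<open>The sieve for coprimality to q and the Euler product for phi(q)/q expand over the same
  subsets of prime factors, so they can be compared term by term; each of the 2 ^ omega(q) terms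
  costs one equidistribution error.\<close>

lemma N_r_estimate:
  fixes p q :: nat
  assumes p: "prime p" and q: "0 < q" "q < p"
  shows "\<bar>real (N_r p q) - real (totient q) / q * totient (p - 1)\<bar> \<le>
    2 ^ card (prime_factors q) * (1 + 2 ^ card (prime_factors (p - 1)) * sqrt p * (1 + ln p))"
    (is "_ \<le> _ * ?E")
proof -
  let ?A = "primitive_roots p" and ?P = "prime_factors q"
  have A: "?A \<subseteq> {..<p}" "card ?A = totient (p - 1)"
    using prime_card_primitive_roots(2)[OF prime_gt_1_nat[OF p] p] by (auto simp: primitive_roots_def atLeast0LessThan)
  have fin: "finite ?A" using A by (auto intro: finite_subset)
  have prod: "\<Prod>S dvd n \<longleftrightarrow> (\<forall>r\<in>S. r dvd n)" if "S \<subseteq> ?P" for S n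
    using that by (intro prod_primes_dvd_iff) (auto intro: finite_subset)
  have "real (N_r p q) = (\<Sum>n | n \<in> ?A \<and> (\<forall>r\<in>?P. \<not> r dvd n). 1)"
    unfolding N_r_def coprime_iff_gcd_eq_1[symmetric] coprime_iff_no_common_prime_factor[OF q(1)] by simp
  also have "\<dots> = (\<Sum>S\<in>Pow ?P. (-1) ^ card S * (\<Sum>n | n \<in> ?A \<and> (\<forall>r\<in>S. r dvd n). 1))"
    using fin by (rule sum_sieve) simp
  also have "\<dots> = (\<Sum>S\<in>Pow ?P. (-1) ^ card S * real (card {n \<in> ?A. \<Prod>S dvd n}))"
    using prod by (intro sum.cong refl) simp
  finally have N: "real (N_r p q) =
    (\<Sum>S\<in>Pow ?P. (-1) ^ card S * real (card {n \<in> ?A. \<Prod>S dvd n}))" .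
  have "real (totient q) / q = (\<Prod>r\<in>?P. 1 - 1 / real r)"
    using q by (simp add: totient_formula2)
  also have "\<dots> = (\<Sum>S\<in>Pow ?P. (-1) ^ card S / real (\<Prod>S))"
    by (simp add: prod_diff_conv_sum prod_dividef)
  finally have tq: "real (totient q) / q = (\<Sum>S\<in>Pow ?P. (-1) ^ card S / real (\<Prod>S))" .
  have "real (N_r p q) - real (totient q) / q * totient (p - 1) =
    (\<Sum>S\<in>Pow ?P. (-1) ^ card S * (real (card {n \<in> ?A. \<Prod>S dvd n}) - real (card ?A) / real (\<Prod>S)))"
    unfolding N A(2) tq sum_distrib_right right_diff_distrib sum_subtractf by simp
  also have "\<bar>\<dots>\<bar> \<le> (\<Sum>S\<in>Pow ?P. ?E)"
  proof (rule order.trans[OF sum_abs sum_mono])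
    fix S assume S: "S \<in> Pow ?P"
    \<comment> \<open>This is where q < p enters: every modulus in the sieve divides q, hence is
      below p as equidistribution demands.\<close>
    hence "\<Prod>S dvd q" by (subst prod) (auto simp: in_prime_factors_iff)
    hence "0 < \<Prod>S" "\<Prod>S < p" using q by (auto dest: dvd_imp_le intro: dvd_pos_nat)
    hence "\<bar>real (card {n \<in> ?A. \<Prod>S dvd n}) - real (card ?A) / real (\<Prod>S)\<bar> \<le> ?E"
      using norm_fourier_primitive_roots_le[OF p]
      by (intro multiples_equidistributed[OF p _ _ A(1)]) auto
    thus "\<bar>(-1) ^ card S * (real (card {n \<in> ?A. \<Prod>S dvd n}) - real (card ?A) / real (\<Prod>S))\<bar> \<le> ?E"
      by (simp add: abs_mult power_abs)
  qed
  also have "\<dots> = 2 ^ card ?P * ?E" by (simp add: card_Pow)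
  finally show ?thesis .
qed

subsection \<open>Asymptotics\<close>

text \<open>A prime r with r at least 2 powr (1 / \<delta>) satisfies 2 \<le> r powr \<delta>, so it
  pays for its own factor 2. At most K prime factors lie below this threshold, and they are absorbed
  into the constant 2 ^ K.\<close>

lemma two_power_card_prime_factors_le:
  fixes \<delta> :: real
  assumes "\<delta> > 0"
  obtains C where "C > 0" "\<And>n :: nat. n > 0 \<Longrightarrow> 2 ^ card (prime_factors n) \<le> C * real n powr \<delta>"
proof
  define K where "K = nat \<lceil>2 powr (1 / \<delta>)\<rceil>"
  show "(2 :: real) ^ K > 0" by simp
  fix n :: nat assume n: "n > 0"
  have large: "2 \<le> real r powr \<delta>" if "\<not> r < K" for r
  proof -
    have "2 powr (1 / \<delta>) \<le> real r" using that unfolding K_def by linarith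
    hence "(2 powr (1 / \<delta>)) powr \<delta> \<le> real r powr \<delta>"
      using assms by (intro powr_mono2) auto
    thus ?thesis using assms by (simp add: powr_powr)
  qed
  have "(2 :: real) ^ card (prime_factors n) = (\<Prod>r\<in>prime_factors n. 2)" by simp
  also have "\<dots> \<le> (\<Prod>r\<in>prime_factors n. (if r < K then 2 else 1) * real r powr \<delta>)"
  proof (rule prod_mono)
    fix r assume "r \<in> prime_factors n"
    hence "1 \<le> real r powr \<delta>" using assms
      by (intro ge_one_powr_ge_zero) (auto simp: in_prime_factors_iff Suc_le_eq prime_gt_0_nat)
    thus "0 \<le> (2 :: real) \<and> 2 \<le> (if r < K then 2 else 1) * real r powr \<delta>"
      using large[of r] by auto
  qed
  also have "\<dots> = (\<Prod>r\<in>prime_factors n. if r < K then 2 else 1) * real (\<Prod>(prime_factors n)) powr \<delta>"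
    by (simp add: prod.distrib prod_powr_distrib)
  also have "\<dots> \<le> 2 ^ K * real n powr \<delta>"
  proof (rule mult_mono)
    have "(\<Prod>r\<in>prime_factors n. if r < K then 2 else 1) =
          (2 :: real) ^ card (prime_factors n \<inter> {r. r < K})"
      by (simp add: prod.If_cases)
    also have "card (prime_factors n \<inter> {r. r < K}) \<le> card {..<K}" by (intro card_mono) auto
    hence "(2 :: real) ^ card (prime_factors n \<inter> {r. r < K}) \<le> 2 ^ K" by simp
    finally show "(\<Prod>r\<in>prime_factors n. if r < K then 2 else 1) \<le> (2 :: real) ^ K" .
    have "\<Prod>(prime_factors n) dvd n"
      by (subst prod_primes_dvd_iff) (auto simp: in_prime_factors_iff)
    hence "\<Prod>(prime_factors n) \<le> n" using n by (rule dvd_imp_le)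
    thus "real (\<Prod>(prime_factors n)) powr \<delta> \<le> real n powr \<delta>"
      using assms by (intro powr_mono2) (auto simp del: of_nat_prod)
  qed auto
  finally show "2 ^ card (prime_factors n) \<le> 2 ^ K * real n powr \<delta>" .
qed

text \<open>Every Euler factor is at least 1/2. This crude bound suffices to keep the main term
  large, since 2 ^ omega(n) is smaller than any fixed positive power of n up to a constant.\<close>

lemma totient_div_ge:
  assumes "n > 0"
  shows "1 / 2 ^ card (prime_factors n) \<le> real (totient n) / real n"
proof -
  have "1 / 2 ^ card (prime_factors n) = (\<Prod>r\<in>prime_factors n. 1 / 2 :: real)"
    by (simp add: power_one_over)
  also have "\<dots> \<le> (\<Prod>r\<in>prime_factors n. 1 - 1 / real r)"
  proof (rule prod_mono)
    fix r assume "r \<in> prime_factors n"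
    hence "2 \<le> r" by (auto simp: in_prime_factors_iff prime_ge_2_nat)
    thus "0 \<le> (1 / 2 :: real) \<and> 1 / 2 \<le> 1 - 1 / real r" by (simp add: field_simps)
  qed
  also have "\<dots> = real (totient n) / real n" using assms by (simp add: totient_formula2)
  finally show ?thesis .
qed

lemma N_r_asymptotics:
  fixes \<epsilon> :: real
  assumes \<epsilon>: "0 < \<epsilon>" "\<epsilon> < 1 / 2"
  shows "\<exists>C. \<forall>\<^sub>F p :: nat in at_top. prime p \<longrightarrow> (\<forall>q :: nat. 0 < q \<and> q < p \<longrightarrow>
           \<bar>real (N_r p q)
             - real (totient q) / real q * (real (totient (p - 1)) / real (p - 1)) * real p\<bar>
           \<le> C * real p powr (1 - \<epsilon>))"
proof -
  \<comment> \<open>Chosen so that 1 / 2 + 4 * \<delta> = 1 - \<epsilon>. The two divisor-type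
    factors use 2 * \<delta> of the exponent, and the rest absorbs the logarithm.\<close>
  define \<delta> where "\<delta> = (1 / 2 - \<epsilon>) / 4"
  have \<delta>: "\<delta> > 0" using \<epsilon> by (simp add: \<delta>_def)
  obtain C where C: "C > 0" "\<And>n :: nat. n > 0 \<Longrightarrow> 2 ^ card (prime_factors n) \<le> C * real n powr \<delta>"
    using two_power_card_prime_factors_le[OF \<delta>] by blast
  \<comment> \<open>The leading 1 covers the passage from phi(p - 1) to p * phi(p - 1) / (p - 1).
    The bound involves p alone, which makes the result uniform in q.\<close>
  define err where "err x = 1 + C * x powr \<delta> * (1 + C * x powr \<delta> * x powr (1 / 2) * (1 + ln x))"
    for x :: real
  have "err \<in> O(\<lambda>x. x powr (1 / 2 + 4 * \<delta>))"
    unfolding err_def using C(1) \<delta> by real_asymp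
  moreover have "1 / 2 + 4 * \<delta> = 1 - \<epsilon>" by (simp add: \<delta>_def field_simps)
  ultimately obtain c where "\<forall>\<^sub>F x in at_top. norm (err x) \<le> c * norm (x powr (1 - \<epsilon>))"
    by (auto elim: landau_o.bigE)
  hence "\<forall>\<^sub>F p :: nat in at_top. norm (err (real p)) \<le> c * norm (real p powr (1 - \<epsilon>))"
    by (rule eventually_compose_filterlim[OF _ filterlim_real_sequentially])
  hence "\<forall>\<^sub>F p :: nat in at_top. prime p \<longrightarrow> (\<forall>q :: nat. 0 < q \<and> q < p \<longrightarrow>
           \<bar>real (N_r p q)
             - real (totient q) / real q * (real (totient (p - 1)) / real (p - 1)) * real p\<bar>
           \<le> c * real p powr (1 - \<epsilon>))"
  proof (eventually_elim, safe)
    fix p q :: nat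
    assume le: "norm (err (real p)) \<le> c * norm (real p powr (1 - \<epsilon>))"
      and p: "prime p" and q: "0 < q" "q < p"
    have p1: "p > 1" using p by (rule prime_gt_1_nat)
    have pow: "2 ^ card (prime_factors n) \<le> C * real p powr \<delta>" if "0 < n" "n \<le> p" for n
      using C(2)[OF that(1)] that C(1) \<delta>
      by (elim order_trans) (intro mult_left_mono powr_mono2, auto)
    define tq where "tq = real (totient q) / q"
    define tp where "tp = real (totient (p - 1)) / real (p - 1)"
    have t: "0 \<le> tq" "tq \<le> 1" "0 \<le> tp" "tp \<le> 1"
      using totient_le[of q] totient_le[of "p - 1"] q p1 by (auto simp: tq_def tp_def)
    have ln: "ln (real p) \<ge> 0" using p1 by simp
    have "real (totient (p - 1)) = tp * (real p - 1)"
      using p1 by (simp add: tp_def of_nat_diff)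
    hence "real (N_r p q) - tq * tp * p = (real (N_r p q) - tq * totient (p - 1)) - tq * tp"
      by (simp only:) (simp add: algebra_simps)
    also have "\<bar>\<dots>\<bar> \<le> \<bar>real (N_r p q) - tq * totient (p - 1)\<bar> + \<bar>tq * tp\<bar>"
      by (rule abs_triangle_ineq4)
    also have "\<dots> \<le> C * real p powr \<delta> * (1 + C * real p powr \<delta> * sqrt p * (1 + ln p)) + 1"
    proof (rule add_mono)
      show "\<bar>tq * tp\<bar> \<le> 1" using t by (simp add: abs_mult mult_le_one)
      have "\<bar>real (N_r p q) - tq * totient (p - 1)\<bar> \<le>
        2 ^ card (prime_factors q) * (1 + 2 ^ card (prime_factors (p - 1)) * sqrt p * (1 + ln p))"
        unfolding tq_def by (rule N_r_estimate[OF p q])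
      also have "\<dots> \<le> C * real p powr \<delta> * (1 + C * real p powr \<delta> * sqrt p * (1 + ln p))"
        using pow[of q] pow[of "p - 1"] q p1 ln C(1)
        by (intro mult_mono add_mono) auto
      finally show "\<bar>real (N_r p q) - tq * totient (p - 1)\<bar> \<le> \<dots>" .
    qed
    also have "\<dots> = err (real p)" by (simp add: err_def powr_half_sqrt)
    also have "\<dots> \<le> c * real p powr (1 - \<epsilon>)" using le by simp
    finally show "\<bar>real (N_r p q) - real (totient q) / real q *
        (real (totient (p - 1)) / real (p - 1)) * real p\<bar> \<le> c * real p powr (1 - \<epsilon>)"
      by (simp add: tq_def tp_def)
  qed
  thus ?thesis by blast
qed

text \<open>The main term is at least a positive constant times p powr (7 / 8): each totient ratio
  loses at most a constant times p powr (1 / 16). With \<epsilon> = 1 / 4 the error is only of order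
  p powr (3 / 4), so the count is eventually positive.\<close>

lemma eventually_coprime_primitive_root:
  "\<forall>\<^sub>F p :: nat in at_top. prime p \<longrightarrow>
     (\<forall>q :: nat. 0 < q \<and> q < p \<longrightarrow> (\<exists>n \<in> primitive_roots p. gcd n q = 1))"
proof -
  obtain C where C: "\<forall>\<^sub>F p :: nat in at_top. prime p \<longrightarrow> (\<forall>q :: nat. 0 < q \<and> q < p \<longrightarrow>
           \<bar>real (N_r p q)
             - real (totient q) / real q * (real (totient (p - 1)) / real (p - 1)) * real p\<bar>
           \<le> C * real p powr (1 - 1 / 4))"
    using N_r_asymptotics[of "1 / 4"] by auto
  obtain D where D: "D > 0"
      "\<And>n :: nat. n > 0 \<Longrightarrow> 2 ^ card (prime_factors n) \<le> D * real n powr (1 / 16)"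
    using two_power_card_prime_factors_le[of "1 / 16"] by auto
  have "\<forall>\<^sub>F x :: real in at_top. C * x powr (1 - 1 / 4) <
          1 / (D * x powr (1 / 16)) * (1 / (D * x powr (1 / 16))) * x"
    using D(1) by real_asymp
  hence "\<forall>\<^sub>F p :: nat in at_top. C * real p powr (1 - 1 / 4) <
          1 / (D * real p powr (1 / 16)) * (1 / (D * real p powr (1 / 16))) * real p"
    by (rule eventually_compose_filterlim[OF _ filterlim_real_sequentially])
  with C show ?thesis
  proof (eventually_elim, safe)
    fix p q :: nat
    assume est: "\<forall>q. 0 < q \<and> q < p \<longrightarrow>
           \<bar>real (N_r p q)
             - real (totient q) / real q * (real (totient (p - 1)) / real (p - 1)) * real p\<bar>
           \<le> C * real p powr (1 - 1 / 4)"
      and less: "C * real p powr (1 - 1 / 4) <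
          1 / (D * real p powr (1 / 16)) * (1 / (D * real p powr (1 / 16))) * real p"
      and p: "prime p" and q: "0 < q" "q < p"
    have p1: "p > 1" using p by (rule prime_gt_1_nat)
    have ge: "1 / (D * real p powr (1 / 16)) \<le> real (totient n) / real n" if "0 < n" "n \<le> p" for n
    proof -
      have "2 ^ card (prime_factors n) \<le> D * real n powr (1 / 16)" using D(2) that by simp
      also have "\<dots> \<le> D * real p powr (1 / 16)"
        using that D(1) by (intro mult_left_mono powr_mono2) auto
      finally have "1 / (D * real p powr (1 / 16)) \<le> 1 / 2 ^ card (prime_factors n)"
        by (intro divide_left_mono) (use D(1) p1 in auto)
      also have "\<dots> \<le> real (totient n) / real n" using that(1) by (rule totient_div_ge)
      finally show ?thesis .
    qed
    note less
    also have "1 / (D * real p powr (1 / 16)) * (1 / (D * real p powr (1 / 16))) * real p \<le>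
        real (totient q) / real q * (real (totient (p - 1)) / real (p - 1)) * real p"
      using ge[of q] ge[of "p - 1"] q p1 D(1) by (intro mult_right_mono mult_mono) auto
    finally have "real (N_r p q) > 0" using est q by (smt (verit))
    hence "{n \<in> primitive_roots p. gcd n q = 1} \<noteq> {}"
      unfolding N_r_def by (metis card.empty of_nat_0 less_irrefl)
    thus "\<exists>n\<in>primitive_roots p. gcd n q = 1" by auto
  qed
qed

theorem theorem1p6:
  shows "(\<forall>\<^sub>F p :: nat in at_top. prime p \<longrightarrow>
            (\<forall>q :: nat. 0 < q \<and> q < p \<longrightarrow> (\<exists>n \<in> primitive_roots p. gcd n q = 1)))
       \<and> (\<exists>\<epsilon>\<^sub>0 :: real. \<epsilon>\<^sub>0 > 0 \<and>
            (\<forall>\<epsilon> :: real. 0 < \<epsilon> \<and> \<epsilon> < \<epsilon>\<^sub>0 \<longrightarrow>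
              (\<exists>C :: real. \<forall>\<^sub>F p :: nat in at_top. prime p \<longrightarrow>
                (\<forall>q :: nat. 0 < q \<and> q < p \<longrightarrow>
                  \<bar>real (N_r p q)
                     - real (totient q) / real q * (real (totient (p - 1)) / real (p - 1)) * real p\<bar>
                    \<le> C * real p powr (1 - \<epsilon>)))))"
  \<comment> \<open>The witness 1 / 2 for \<open>\<epsilon>\<^sub>0\<close> matches the square-root
    size of the Fourier coefficients.\<close>
  using eventually_coprime_primitive_root N_r_asymptotics
  by (intro conjI exI[of _ "1 / 2"]) auto

end
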